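(* Let $0<\varepsilon<0.5$ and let $n>m\ge 1$ be integers. There exists a dataset $P\subset\mathbb{R}$ of size $n$ such that every $\varepsilon$-coreset of $P$ for the robust geometric median problem (with $m$ outliers) has size $\Omega\!\left(\frac{m}{n-m}\right)$.
   Context: For a finite dataset $P\subset\mathbb{R}^d$ and an integer $m\ge 0$, the robust geometric median cost of a center $c\in\mathbb{R}^d$ is $\mathrm{cost}^{(m)}(P,c):=\min_{L\subseteq P,\,|L|=m}\sum_{p\in P\setminus L}\|p-c\|_2$. For a weighted set $S$ with weights $w:S\to\mathbb{R}^+$ and total weight $w(S)=\sum_{p\in S}w(p)$, let $\mathcal{W}$ be the set of functions $w':S\to\mathbb{R}^+$ with $w'(p)\le w(p)$ for all $p$ and $\sum_{p}w'(p)=w(S)-m$; define $\mathrm{cost}^{(m)}(S,c):=\min_{w'\in\mathcal{W}}\sum_{p\in S}w'(p)\|p-c\|_2$. Given $P$ of size $n$, $m\ge 1$ and $\varepsilon\in(0,1)$, a weighted subset $S\subseteq P$ with weights $w$ is an $\varepsilon$-coreset of $P$ for robust geometric median if $w(S)=n$ and $\mathrm{cost}^{(m)}(S,c)\in(1\pm\varepsilon)\,\mathrm{cost}^{(m)}(P,c)$ for every $c\in\mathbb{R}^d$. The size of a coreset is $|S|$. *)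

theory Defs
  imports "HOL-Analysis.Analysis"
begin

definition robust_cost :: "nat \<Rightarrow> 'a::euclidean_space set \<Rightarrow> 'a \<Rightarrow> real" where
  "robust_cost m P c = Min ((\<lambda>L. \<Sum>p\<in>P - L. norm (p - c)) ` {L. L \<subseteq> P \<and> card L = m})"

text \<open>
  Weights are nonnegative: a reduced weight has to be allowed to vanish, since otherwise the
  minimum over all reduced weights need not be attained.
\<close>

definition reduced_weights :: "nat \<Rightarrow> 'a set \<Rightarrow> ('a \<Rightarrow> real) \<Rightarrow> ('a \<Rightarrow> real) set" where
  "reduced_weights m S w =
     {w'. (\<forall>p\<in>S. 0 \<le> w' p \<and> w' p \<le> w p) \<and> (\<Sum>p\<in>S. w' p) = (\<Sum>p\<in>S. w p) - real m}"

text \<open>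
  The minimum over the (infinite) set of reduced weights is written as an infimum; it is attained
  whenever \<open>m\<close> is at most the total weight, see \<open>weighted_robust_cost_attained\<close>.
\<close>

definition weighted_robust_cost ::
    "nat \<Rightarrow> 'a::euclidean_space set \<Rightarrow> ('a \<Rightarrow> real) \<Rightarrow> 'a \<Rightarrow> real" where
  "weighted_robust_cost m S w c =
     (INF w'\<in>reduced_weights m S w. \<Sum>p\<in>S. w' p * norm (p - c))"

definition robust_median_coreset ::
    "real \<Rightarrow> nat \<Rightarrow> 'a::euclidean_space set \<Rightarrow> 'a set \<Rightarrow> ('a \<Rightarrow> real) \<Rightarrow> bool" where
  "robust_median_coreset \<epsilon> m P S w \<longleftrightarrow>
     S \<subseteq> P \<and> (\<forall>p\<in>S. 0 \<le> w p) \<and> (\<Sum>p\<in>S. w p) = real (card P) \<and>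
     (\<forall>c. (1 - \<epsilon>) * robust_cost m P c \<le> weighted_robust_cost m S w c \<and>
          weighted_robust_cost m S w c \<le> (1 + \<epsilon>) * robust_cost m P c)"

lemma weighted_robust_cost_attained:
  fixes S :: "'a::euclidean_space set"
  assumes fin: "finite S" and w: "\<forall>p\<in>S. 0 \<le> w p" and m: "real m \<le> (\<Sum>p\<in>S. w p)"
  shows "\<exists>w'\<in>reduced_weights m S w.
    weighted_robust_cost m S w c = (\<Sum>p\<in>S. w' p * norm (p - c)) \<and>
    (\<forall>v\<in>reduced_weights m S w. (\<Sum>p\<in>S. w' p * norm (p - c)) \<le> (\<Sum>p\<in>S. v p * norm (p - c)))"
proof -
  let ?f = "\<lambda>v. \<Sum>p\<in>S. v p * norm (p - c)"
  define K where "K = (\<Pi>\<^sub>E p\<in>UNIV. if p \<in> S then {0..w p} else {0})"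
  define C where "C = K \<inter> {v. (\<Sum>p\<in>S. v p) = (\<Sum>p\<in>S. w p) - real m}"
  have "compactin (product_topology (\<lambda>_. euclidean) UNIV) K"
    unfolding K_def by (subst compactin_PiE) auto
  then have "compact K"
    by (simp add: euclidean_product_topology)
  moreover have "closed {v. (\<Sum>p\<in>S. v p) = (\<Sum>p\<in>S. w p) - real m}"
    by (intro closed_Collect_eq continuous_on_sum continuous_on_product_coordinates
        continuous_on_const)
  ultimately have cpt: "compact C"
    unfolding C_def by (rule compact_Int_closed)
  define W where "W = (\<Sum>p\<in>S. w p)"
  define r where "r = (if W = 0 then 0 else (W - m) / W)"
  have W0: "0 \<le> W" unfolding W_def using w by (simp add: sum_nonneg)
  have r: "0 \<le> r" "r \<le> 1" "r * W = W - m"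
    using m W0 by (auto simp: r_def W_def[symmetric] field_simps)
  have "(\<lambda>p. if p \<in> S then r * w p else 0) \<in> C"
    using r w by (auto simp: C_def K_def W_def sum_distrib_left[symmetric] mult_left_le_one_le)
  then have ne: "C \<noteq> {}" by blast
  have cont: "continuous_on C ?f"
    by (intro continuous_intros continuous_on_subset[OF continuous_on_product_coordinates]) auto
  obtain u where u: "u \<in> C" "\<And>v. v \<in> C \<Longrightarrow> ?f u \<le> ?f v"
    using continuous_attains_inf[OF cpt ne cont] by blast
  have uR: "u \<in> reduced_weights m S w"
    using u(1) by (fastforce simp: C_def K_def reduced_weights_def PiE_def Pi_def split: if_splits)
  have min: "?f u \<le> ?f v" if v: "v \<in> reduced_weights m S w" for v
  proof -
    have "(\<lambda>p. if p \<in> S then v p else 0) \<in> C"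
      using v by (auto simp: C_def K_def reduced_weights_def)
    from u(2)[OF this] show ?thesis by simp
  qed
  have "weighted_robust_cost m S w c = ?f u"
    unfolding weighted_robust_cost_def using uR min by (intro cInf_eq_minimum) auto
  with uR min show ?thesis by blast
qed

end

theory Submission
  imports Defs
begin

text \<open>
  Put \<open>k = n - m\<close> and place the points in tight clusters of \<open>k\<close> points each that are far apart.
  At a center inside a cluster the \<open>k\<close> inliers are that cluster, so the robust cost is small. A
  weighted set avoiding the cluster still has to serve weight \<open>k\<close> from far away and is too
  expensive. Hence a coreset meets each of the \<open>n div k > m / k\<close> full clusters.
\<close>

lemma robust_cost_le:
  assumes "finite P" and "A \<subseteq> P" and "card A + m = card P"
  shows "robust_cost m P c \<le> (\<Sum>p\<in>A. norm (p - c))"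
proof -
  have "finite A" using assms(1,2) by (rule rev_finite_subset)
  then have "card (P - A) = m"
    using assms by (simp add: card_Diff_subset)
  moreover have "P - (P - A) = A" using assms(2) by blast
  ultimately have "(\<Sum>p\<in>A. norm (p - c)) \<in>
      (\<lambda>L. \<Sum>p\<in>P - L. norm (p - c)) ` {L. L \<subseteq> P \<and> card L = m}"
    by (intro image_eqI[where x = "P - A"]) auto
  moreover have "finite {L. L \<subseteq> P \<and> card L = m}"
    using assms(1) by simp
  ultimately show ?thesis
    unfolding robust_cost_def by (intro Min_le) auto
qed

lemma weighted_robust_cost_ge:
  assumes "finite S" and "\<forall>p\<in>S. 0 \<le> w p" and "real m \<le> (\<Sum>p\<in>S. w p)"
    and "\<And>p. p \<in> S \<Longrightarrow> d \<le> norm (p - c)"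
  shows "((\<Sum>p\<in>S. w p) - real m) * d \<le> weighted_robust_cost m S w c"
proof -
  \<comment> \<open>Since \<open>m\<close> is at most the total weight, the infimum is attained, so
    it can be replaced by the cost of one concrete reduced weight \<open>u\<close>.\<close>
  obtain u where u: "u \<in> reduced_weights m S w"
    and eq: "weighted_robust_cost m S w c = (\<Sum>p\<in>S. u p * norm (p - c))"
    using weighted_robust_cost_attained[OF assms(1-3)] by blast
  have "((\<Sum>p\<in>S. w p) - real m) * d = (\<Sum>p\<in>S. u p * d)"
    using u by (simp add: reduced_weights_def sum_distrib_right[symmetric])
  also have "\<dots> \<le> (\<Sum>p\<in>S. u p * norm (p - c))"
    using u assms(4) by (intro sum_mono mult_left_mono) (auto simp: reduced_weights_def)
  finally show ?thesis using eq by simp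
qed

text \<open>If \<open>S\<close> missed \<open>A\<close>, all its weight would lie at distance at
  least \<open>d\<close> from \<open>c\<close>. Keeping exactly \<open>A\<close> as inliers bounds
  the true cost by \<open>card A * r\<close>, so the upper coreset inequality would force d \<le> (1
  + \<epsilon>) r.\<close>

lemma coreset_meets_cluster:
  assumes core: "robust_median_coreset \<epsilon> m P S w" and \<epsilon>: "0 \<le> 1 + \<epsilon>"
    and P: "finite P" "A \<subseteq> P" "card A + m = card P" "A \<noteq> {}"
    and near: "\<And>p. p \<in> A \<Longrightarrow> norm (p - c) \<le> r"
    and far: "\<And>p. p \<in> P - A \<Longrightarrow> d \<le> norm (p - c)"
    and d: "(1 + \<epsilon>) * r < d"
  shows "S \<inter> A \<noteq> {}"
proof
  assume disj: "S \<inter> A = {}"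
  have S: "S \<subseteq> P" "\<forall>p\<in>S. 0 \<le> w p" "(\<Sum>p\<in>S. w p) = real (card P)"
    and up: "weighted_robust_cost m S w c \<le> (1 + \<epsilon>) * robust_cost m P c"
    using core by (auto simp: robust_median_coreset_def)
  have "finite S" using P(1) S(1) by (rule rev_finite_subset)
  then have "((\<Sum>p\<in>S. w p) - real m) * d \<le> weighted_robust_cost m S w c"
    using S P(3) disj far by (intro weighted_robust_cost_ge) auto
  \<comment> \<open>The weight left after discarding \<open>m\<close> equals the number of inliers,
    so \<open>card A\<close> cancels at the end.\<close>
  also have "(\<Sum>p\<in>S. w p) - real m = real (card A)"
    using S(3) P(3) by linarith
  also note up
  also have "robust_cost m P c \<le> (\<Sum>p\<in>A. norm (p - c))"
    using P(1-3) by (rule robust_cost_le)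
  also have "\<dots> \<le> real (card A) * r"
    using near by (rule sum_bounded_above)
  finally have "real (card A) * d \<le> real (card A) * ((1 + \<epsilon>) * r)"
    using \<epsilon> by (simp add: mult_left_mono mult.left_commute)
  moreover have "0 < card A"
    using P(1,2,4) by (auto simp: card_gt_0_iff intro: rev_finite_subset)
  ultimately show False using d by simp
qed

text \<open>The quotient \<open>t div k\<close> is the cluster index. A cluster consists of
  \<open>k\<close> consecutive integers, and each new cluster is shifted by a further
  \<open>3 * k\<close>, so neighbouring clusters are \<open>3 * k + 1\<close> apart.\<close>

definition cluster_point :: "nat \<Rightarrow> nat \<Rightarrow> real" where
  "cluster_point k t = real (t + 3 * k * (t div k))"

lemma inj_cluster_point: "inj (cluster_point k)"
proof (rule linorder_injI)
  fix s t :: nat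
  assume "s < t"
  then have "3 * k * (s div k) \<le> 3 * k * (t div k)"
    by (intro mult_le_mono2 div_le_mono) simp
  with \<open>s < t\<close> show "cluster_point k s \<noteq> cluster_point k t"
    unfolding cluster_point_def of_nat_eq_iff by linarith
qed

lemma cluster_point_near:
  assumes "0 < k" and "t div k = j"
  shows "norm (cluster_point k t - cluster_point k (j * k)) \<le> real k"
proof -
  have "t = j * k + t mod k" using assms(2) by auto
  then have "real t = real (j * k) + real (t mod k)"
    by (metis of_nat_add)
  moreover have "t mod k < k" using assms(1) by simp
  ultimately show ?thesis using assms by (simp add: cluster_point_def)
qed

lemma cluster_point_far:
  assumes "0 < k" and "t div k \<noteq> j"
  shows "3 * real k \<le> norm (cluster_point k t - cluster_point k (j * k))"
proof -
  \<comment> \<open>Stated for an ordered pair so that it serves points on either side of the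
    center, which is the first point of cluster \<open>j\<close>.\<close>
  have sep: "cluster_point k a + 3 * real k \<le> cluster_point k b" if "a div k < b div k" for a b
  proof -
    have "a \<le> b"
      using that by (meson div_le_mono leD nat_le_linear)
    moreover have "3 * k * (a div k + 1) \<le> 3 * k * (b div k)"
      using that by (intro mult_le_mono2) simp
    ultimately have "a + 3 * k * (a div k) + 3 * k \<le> b + 3 * k * (b div k)"
      by simp
    then have "real (a + 3 * k * (a div k) + 3 * k) \<le> real (b + 3 * k * (b div k))"
      unfolding of_nat_le_iff .
    then show ?thesis by (simp add: cluster_point_def)
  qed
  have "j * k div k = j" using assms(1) by simp
  then show ?thesis
    using sep[of t "j * k"] sep[of "j * k" t] assms(2) by (cases "t div k < j") auto
qed

text \<open>Each full cluster contains a point of \<open>S\<close>, and distinct clusters are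
  disjoint. An incomplete last cluster of \<open>n mod k\<close> points is not counted.\<close>

lemma card_coreset_cluster_points:
  assumes core: "robust_median_coreset \<epsilon> m (cluster_point k ` {..<n}) S w"
    and \<epsilon>: "0 \<le> 1 + \<epsilon>" "\<epsilon> < 2" and k: "0 < k" "k + m = n"
  shows "n div k \<le> card S"
proof -
  let ?p = "cluster_point k"
  define T where "T = {t. t < n \<and> ?p t \<in> S}"
  have inj: "inj_on ?p X" for X
    using inj_cluster_point by (rule inj_on_subset) simp
  have "{..<n div k} \<subseteq> (\<lambda>t. t div k) ` T"
  proof
    fix j assume "j \<in> {..<n div k}"
    then have "Suc j * k \<le> n"
      using k(1) by (metis Suc_leI less_eq_div_iff_mult_less_eq lessThan_iff)
    \<comment> \<open>Cluster \<open>j\<close> is full, so it has exactly \<open>k = n - m\<close>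
      points, the number of inliers.\<close>
    then have jn: "j * k + k \<le> n" by simp
    define A where "A = ?p ` {j * k..<j * k + k}"
    have block: "t \<in> {j * k..<j * k + k} \<longleftrightarrow> t div k = j" for t
      using k(1) by (auto simp: div_nat_eqI mult.commute dividend_less_times_div add.commute)
    have "S \<inter> A \<noteq> {}"
    proof (rule coreset_meets_cluster[OF core \<epsilon>(1)])
      show "A \<subseteq> ?p ` {..<n}" unfolding A_def using jn by (intro image_mono) auto
      show "card A + m = card (?p ` {..<n})"
        using k(2) by (simp add: A_def card_image[OF inj])
      show "A \<noteq> {}" using k(1) by (simp add: A_def)
      show "norm (x - ?p (j * k)) \<le> real k" if "x \<in> A" for x
        using that cluster_point_near[OF k(1)] block unfolding A_def by blast
      show "3 * real k \<le> norm (x - ?p (j * k))" if "x \<in> ?p ` {..<n} - A" for x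
        using that cluster_point_far[OF k(1)] block unfolding A_def by blast
      \<comment> \<open>Separation three times the radius bound \<open>k\<close> beats the factor 1
        + \<epsilon> for every \<epsilon> < 2.\<close>
      show "(1 + \<epsilon>) * real k < 3 * real k" using \<epsilon>(2) k(1) by simp
    qed simp
    then obtain t where "t \<in> {j * k..<j * k + k}" "?p t \<in> S"
      unfolding A_def by blast
    then show "j \<in> (\<lambda>t. t div k) ` T"
      using jn block[of t] by (intro image_eqI[where x = t]) (auto simp: T_def)
  qed
  moreover have "finite T" by (simp add: T_def)
  ultimately have "n div k \<le> card T"
    by (metis card_lessThan surj_card_le)
  also have "S = ?p ` T"
    using core by (auto simp: T_def robust_median_coreset_def)
  then have "card T = card S" by (simp add: card_image[OF inj])
  finally show ?thesis .
qed

theorem theorem1p1: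
  shows "\<exists>C>0. \<forall>(\<epsilon>::real) (n::nat) (m::nat).
    0 < \<epsilon> \<and> \<epsilon> < 1/2 \<and> 1 \<le> m \<and> m < n \<longrightarrow>
    (\<exists>P::real set. finite P \<and> card P = n \<and>
      (\<forall>S w. robust_median_coreset \<epsilon> m P S w \<longrightarrow>
        real (card S) \<ge> C * (real m / (real n - real m))))"
proof (intro exI[of _ "1::real"] conjI allI impI)
  fix \<epsilon> :: real and n m :: nat
  assume H: "0 < \<epsilon> \<and> \<epsilon> < 1/2 \<and> 1 \<le> m \<and> m < n"
  define k where "k = n - m"
  have k: "0 < k" "k + m = n" using H by (auto simp: k_def)
  have bound: "1 * (real m / (real n - real m)) \<le> real (card S)"
    if "robust_median_coreset \<epsilon> m (cluster_point k ` {..<n}) S w" for S w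
  proof -
    have "n div k \<le> card S"
      using card_coreset_cluster_points[OF that] H k by simp
    then have "n div k * k \<le> card S * k" by (rule mult_le_mono1)
    \<comment> \<open>The remainder is less than \<open>k\<close>, so subtracting \<open>k\<close>
      from \<open>n\<close> leaves \<open>m\<close> below \<open>n div k * k\<close>. Hence rounding
      down costs nothing and the constant 1 works.\<close>
    moreover have "n = n div k * k + n mod k" "n mod k < k" using k(1) by simp_all
    ultimately have "m \<le> card S * k" using k(2) by linarith
    then have "real m \<le> real (card S) * real k"
      by (metis of_nat_le_iff of_nat_mult)
    moreover have "real n - real m = real k" using k(2) by linarith
    ultimately show ?thesis using k(1) by (simp add: pos_divide_le_eq)
  qed
  show "\<exists>P::real set. finite P \<and> card P = n \<and>
      (\<forall>S w. robust_median_coreset \<epsilon> m P S w \<longrightarrow>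
        real (card S) \<ge> 1 * (real m / (real n - real m)))"
    using bound inj_on_subset[OF inj_cluster_point]
    by (intro exI[of _ "cluster_point k ` {..<n}"]) (simp add: card_image)
qed simp

end
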